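(* Let $q>0$ and let $X$ be a real random variable. Then $X$ is $q$-subweibull if and only if condition (1) holds, and $X$ is $q$-subweibull if and only if condition (2) holds, where: (1) (Tail bound) there exists $K>0$ such that $$\limsup_{t\to\infty}\Pr(|X|>t)\exp\big((t/K)^q\big)<\infty;$$ (2) (Growth rate of absolute moments) $$\limsup_{p\to\infty}\frac{\big(\mathbb{E}[|X|^p]\big)^{1/p}}{p^{1/q}}<\infty.$$
   Context: For $q>0$, a real random variable $X$ is $q$-subweibull if $\mathbb{E}[\exp(\lambda^q|X|^q)]<\infty$ for some $\lambda>0$. In (2), $p$ ranges over real numbers $p\geq 1$, and absolute moments take values in $[0,\infty]$. *)

theory Defs
  imports "HOL-Probability.Probability"
begin

text \<open>Expectations of nonnegative variables are taken in \<open>[0, \<infinity>]\<close>, as Lebesgue integrals.\<close>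

definition subweibull :: "'a measure \<Rightarrow> real \<Rightarrow> ('a \<Rightarrow> real) \<Rightarrow> bool" where
  "subweibull M q X \<longleftrightarrow>
     (\<exists>l>0. (\<integral>\<^sup>+ x. ennreal (exp (l powr q * \<bar>X x\<bar> powr q)) \<partial>M) < \<infinity>)"

text \<open>Powers with positive real exponent on \<open>[0, \<infinity>]\<close>, with \<open>\<infinity>\<^sup>r = \<infinity>\<close> and \<open>0\<^sup>r = 0\<close>.\<close>

definition ennreal_powr :: "ennreal \<Rightarrow> real \<Rightarrow> ennreal" where
  "ennreal_powr a r = (if a = \<infinity> then \<infinity> else ennreal (enn2real a powr r))"

definition abs_moment :: "'a measure \<Rightarrow> ('a \<Rightarrow> real) \<Rightarrow> real \<Rightarrow> ennreal" where
  "abs_moment M X p = (\<integral>\<^sup>+ x. ennreal (\<bar>X x\<bar> powr p) \<partial>M)"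

end

theory Submission
  imports Defs "HOL-Real_Asymp.Real_Asymp"
begin

text \<open>Subweibull implies polynomial moment growth because \<open>y\<^sup>s \<le> s\<^sup>s e\<^sup>y\<close>, applied with
  \<open>y = (l |X|)\<^sup>q\<close> and \<open>s = p / q\<close>. Moment growth \<open>(E |X|\<^sup>p)\<^sup>1\<^sup>/\<^sup>p \<le> B p\<^sup>1\<^sup>/\<^sup>q\<close> gives the tail bound by
  Markov's inequality for the power \<open>p = (t / (e B))\<^sup>q\<close>, at which \<open>(B p\<^sup>1\<^sup>/\<^sup>q / t)\<^sup>p = e\<^sup>-\<^sup>p\<close>. Finally the
  tail bound for \<open>Z = (|X| / K)\<^sup>q\<close> makes \<open>E exp (Z / 2)\<close> finite by slicing at the integers.\<close>

section \<open>Finite upper limits as eventual bounds\<close>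

lemma Limsup_ereal_less_top_iff:
  fixes f :: "'b \<Rightarrow> ereal"
  shows "Limsup F f < \<infinity> \<longleftrightarrow> (\<exists>C::real. eventually (\<lambda>x. f x \<le> ereal C) F)"
proof
  assume "Limsup F f < \<infinity>"
  then obtain n :: nat where "Limsup F f < ereal (real n)"
    using less_PInf_Ex_of_nat by auto
  from Limsup_lessD[OF this] have "eventually (\<lambda>x. f x \<le> ereal (real n)) F"
    by (rule eventually_mono) simp
  then show "\<exists>C::real. eventually (\<lambda>x. f x \<le> ereal C) F" ..
next
  assume "\<exists>C::real. eventually (\<lambda>x. f x \<le> ereal C) F"
  then obtain C where "eventually (\<lambda>x. f x \<le> ereal C) F" by blast
  then have "Limsup F f \<le> ereal C" by (rule Limsup_bounded)
  also have "\<dots> < \<infinity>" by simp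
  finally show "Limsup F f < \<infinity>" .
qed

text \<open>\<open>C\<close> is asked to be positive because it later becomes the constant
  \<open>B\<close> of the moment bound, and the tail scale \<open>exp 1 * B\<close> has to be
  positive.\<close>

lemma Limsup_ennreal_less_top_iff:
  fixes f :: "'b \<Rightarrow> ennreal"
  shows "Limsup F f < \<infinity> \<longleftrightarrow> (\<exists>C>0. eventually (\<lambda>x. f x \<le> ennreal C) F)"
proof
  assume "Limsup F f < \<infinity>"
  then obtain y where y: "Limsup F f < y" "y < \<infinity>"
    using dense by blast
  have "y \<le> ennreal (enn2real y + 1)"
    using y by (cases y) (auto intro!: ennreal_leI)
  then have "eventually (\<lambda>x. f x \<le> ennreal (enn2real y + 1)) F"
    using Limsup_lessD[OF y(1)] by (auto elim!: eventually_mono)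
  then show "\<exists>C>0. eventually (\<lambda>x. f x \<le> ennreal C) F"
    by (meson add_nonneg_pos enn2real_nonneg zero_less_one)
next
  assume "\<exists>C>0. eventually (\<lambda>x. f x \<le> ennreal C) F"
  then obtain C where "eventually (\<lambda>x. f x \<le> ennreal C) F" by blast
  then have "Limsup F f \<le> ennreal C" by (rule Limsup_bounded)
  also have "\<dots> < \<infinity>" by simp
  finally show "Limsup F f < \<infinity>" .
qed

section \<open>Inequalities for powers and integrals\<close>

lemma powr_less_base_iff:
  fixes a x y :: real
  assumes "a > 0" "x \<ge> 0" "y \<ge> 0"
  shows "x powr a < y powr a \<longleftrightarrow> x < y"
  using assms powr_less_mono2[of a x y] powr_mono2[of a y x] by linarith

lemma powr_le_base_iff:
  fixes a x y :: real
  assumes "a > 0" "x \<ge> 0" "y \<ge> 0"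
  shows "x powr a \<le> y powr a \<longleftrightarrow> x \<le> y"
  using powr_less_base_iff[OF assms(1,3,2)] by linarith

text \<open>Raising to the power \<open>p\<close> preserves and reflects order, so the growth rate
  turns into a bound free of roots and quotients. For \<open>a = \<infinity>\<close> both sides
  fail.\<close>

lemma ennreal_powr_divide_le_iff:
  assumes "p > 0" "B \<ge> 0" "c > 0"
  shows "ennreal_powr a (1 / p) / ennreal c \<le> ennreal B \<longleftrightarrow> a \<le> ennreal ((B * c) powr p)"
proof (cases a)
  case top
  then show ?thesis by (simp add: ennreal_powr_def ennreal_top_divide top_unique)
next
  case (real r)
  have "ennreal_powr a (1 / p) / ennreal c \<le> ennreal B \<longleftrightarrow> r powr (1 / p) \<le> B * c"
    using assms real by (simp add: ennreal_powr_def divide_ennreal pos_divide_le_eq)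
  also have "\<dots> \<longleftrightarrow> (r powr (1 / p)) powr p \<le> (B * c) powr p"
    using assms by (intro powr_le_base_iff[symmetric]) auto
  also have "(r powr (1 / p)) powr p = r"
    using assms real by (simp add: powr_powr)
  finally show ?thesis using real by simp
qed

text \<open>Markov's inequality: \<open>c * indicator A\<close> lies below \<open>f\<close>
  everywhere.\<close>

lemma emeasure_mult_le_nn_integral:
  assumes "\<And>x. x \<in> A \<Longrightarrow> c \<le> f x" "A \<in> sets M"
  shows "emeasure M A * c \<le> (\<integral>\<^sup>+x. f x \<partial>M)"
proof -
  have "emeasure M A * c = (\<integral>\<^sup>+x. c * indicator A x \<partial>M)"
    using assms(2) by (simp add: nn_integral_cmult_indicator mult.commute)
  also have "\<dots> \<le> (\<integral>\<^sup>+x. f x \<partial>M)"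
    using assms(1) by (intro nn_integral_mono) (auto simp: indicator_def)
  finally show ?thesis .
qed

lemma powr_le_powr_self_mult_exp:
  fixes y s :: real
  assumes "y \<ge> 0" "s > 0"
  shows "y powr s \<le> s powr s * exp y"
proof -
  have "y powr s = s powr s * (y / s) powr s"
    using assms by (simp add: powr_mult[symmetric])
  \<comment> \<open>From z <= 1 + z <= exp z at z = \<open>y / s\<close>; the exponent
    \<open>s\<close> then cancels the denominator.\<close>
  also have "(y / s) powr s \<le> exp (y / s) powr s"
    using assms exp_ge_add_one_self[of "y / s"] by (intro powr_mono2) (simp_all del: exp_ge_add_one_self)
  also have "exp (y / s) powr s = exp y"
    using assms by (simp add: powr_def)
  finally show ?thesis by (simp add: mult_left_mono)
qed

section \<open>Exponential moments and tails\<close>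

context prob_space
begin

text \<open>Markov's inequality for \<open>exp (l powr q * \<bar>X x\<bar> powr q)\<close> on the
  event that |X| exceeds \<open>t\<close>. This gives \<open>K = 1 / l\<close>, with the exponential
  moment itself as \<open>C\<close>.\<close>

lemma subweibull_imp_tail:
  assumes [measurable]: "X \<in> borel_measurable M" and "q > 0" and "subweibull M q X"
  obtains K C where "K > 0"
    "\<And>t. t \<ge> 0 \<Longrightarrow> prob {x \<in> space M. \<bar>X x\<bar> > t} * exp ((t / K) powr q) \<le> C"
proof -
  obtain l where l: "l > 0" "(\<integral>\<^sup>+ x. ennreal (exp (l powr q * \<bar>X x\<bar> powr q)) \<partial>M) < \<infinity>"
    using assms unfolding subweibull_def by blast
  then obtain C where C: "C \<ge> 0" "(\<integral>\<^sup>+ x. ennreal (exp (l powr q * \<bar>X x\<bar> powr q)) \<partial>M) = ennreal C"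
    by (metis ennreal_cases infinity_ennreal_def less_irrefl)
  have "prob {x \<in> space M. \<bar>X x\<bar> > t} * exp ((t / (1 / l)) powr q) \<le> C" if "t \<ge> 0" for t
  proof -
    have "exp ((t / (1 / l)) powr q) \<le> exp (l powr q * \<bar>X x\<bar> powr q)" if "\<bar>X x\<bar> > t" for x
      using that \<open>t \<ge> 0\<close> l assms(2)
      by (auto simp: powr_mult mult.commute[of t] intro!: powr_mono2 mult_left_mono)
    then have "emeasure M {x \<in> space M. \<bar>X x\<bar> > t} * ennreal (exp ((t / (1 / l)) powr q))
        \<le> (\<integral>\<^sup>+ x. ennreal (exp (l powr q * \<bar>X x\<bar> powr q)) \<partial>M)"
      by (intro emeasure_mult_le_nn_integral ennreal_leI) auto
    then show ?thesis
      using C by (simp add: emeasure_eq_measure ennreal_mult'[symmetric])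
  qed
  then show thesis using that[of "1 / l" C] l by simp
qed

text \<open>Where n < Z <= n + 1 the integrand is at most exp ((n + 1) / 2), on a set of probability
  at most C exp (-n). Halving the exponent is what leaves a convergent geometric series, of ratio
  exp (-1/2).\<close>

lemma tail_imp_nn_integral_exp_half_finite:
  assumes [measurable]: "Z \<in> borel_measurable M"
    and bound: "\<And>n::nat. prob {x \<in> space M. Z x > real n} \<le> C * exp (- real n)"
  shows "(\<integral>\<^sup>+ x. ennreal (exp (Z x / 2)) \<partial>M) < \<infinity>"
proof -
  \<comment> \<open>Whole tails replace the slices: the overcounting only enlarges the upper bound,
    and the hypothesis applies to them directly.\<close>
  define A where "A n = {x \<in> space M. Z x > real n}" for n :: nat
  have [measurable]: "A n \<in> sets M" for n unfolding A_def by measurable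
  have C: "C \<ge> 0"
    using order_trans[OF measure_nonneg bound[of 0]] by simp
  have "ennreal (exp (Z x / 2)) \<le> ennreal (exp (1 / 2))
      + (\<Sum>n. ennreal (exp ((real n + 1) / 2)) * indicator (A n) x)" if x: "x \<in> space M" for x
  proof (cases "Z x \<le> 0")
    case True
    then have "ennreal (exp (Z x / 2)) \<le> ennreal (exp (1 / 2))"
      by (intro ennreal_leI) auto
    then show ?thesis by (simp add: add_increasing2)
  next
    case False
    \<comment> \<open>The ceiling minus one, not the floor: at an integer value of
      \<open>Z x\<close> the strict inequality defining \<open>A n\<close> must still hold.\<close>
    define n where "n = nat (\<lceil>Z x\<rceil> - 1)"
    have n: "real n < Z x" "Z x \<le> real n + 1"
      using False unfolding n_def by linarith+
    have "ennreal (exp (Z x / 2)) \<le> ennreal (exp ((real n + 1) / 2)) * indicator (A n) x"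
      using n x by (auto simp: A_def intro!: ennreal_leI)
    also have "\<dots> = (\<Sum>k\<in>{n}. ennreal (exp ((real k + 1) / 2)) * indicator (A k) x)"
      by (subst sum.insert) simp_all
    also have "\<dots> \<le> (\<Sum>k. ennreal (exp ((real k + 1) / 2)) * indicator (A k) x)"
      by (intro sum_le_suminf) auto
    finally show ?thesis by (simp add: add_increasing)
  qed
  then have "(\<integral>\<^sup>+ x. ennreal (exp (Z x / 2)) \<partial>M) \<le> (\<integral>\<^sup>+ x. ennreal (exp (1 / 2))
      + (\<Sum>n. ennreal (exp ((real n + 1) / 2)) * indicator (A n) x) \<partial>M)"
    by (rule nn_integral_mono)
  also have "\<dots> = ennreal (exp (1 / 2)) + (\<Sum>n. ennreal (exp ((real n + 1) / 2)) * emeasure M (A n))"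
    by (simp add: nn_integral_add nn_integral_suminf nn_integral_cmult_indicator emeasure_space_1)
  also have "(\<Sum>n. ennreal (exp ((real n + 1) / 2)) * emeasure M (A n))
      \<le> (\<Sum>n. ennreal (C * exp (1 / 2) * exp (- 1 / 2) ^ n))"
  proof (intro suminf_le allI)
    fix n :: nat
    have "exp ((real n + 1) / 2) * prob (A n) \<le> exp ((real n + 1) / 2) * (C * exp (- real n))"
      using bound[of n] by (simp add: A_def)
    also have "\<dots> = C * exp (1 / 2) * exp (- 1 / 2) ^ n"
      by (simp add: exp_of_nat_mult[symmetric] exp_add[symmetric] field_simps)
    finally show "ennreal (exp ((real n + 1) / 2)) * emeasure M (A n)
        \<le> ennreal (C * exp (1 / 2) * exp (- 1 / 2) ^ n)"
      by (simp add: emeasure_eq_measure ennreal_mult'[symmetric] ennreal_leI)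
  qed auto
  also have "\<dots> = ennreal (\<Sum>n. C * exp (1 / 2) * exp (- 1 / 2) ^ n)"
    using C by (intro suminf_ennreal2 summable_mult summable_geometric) auto
  finally show ?thesis
    by (auto simp: le_less_trans top_unique less_top add_left_mono elim!: le_less_trans)
qed

lemma tail_imp_subweibull:
  assumes [measurable]: "X \<in> borel_measurable M" and "q > 0" and "K > 0"
    and "eventually (\<lambda>t. prob {x \<in> space M. \<bar>X x\<bar> > t} * exp ((t / K) powr q) \<le> C) at_top"
  shows "subweibull M q X"
proof -
  obtain t0 where t0: "\<And>t. t \<ge> t0 \<Longrightarrow> prob {x \<in> space M. \<bar>X x\<bar> > t} * exp ((t / K) powr q) \<le> C"
    using assms(4) by (auto simp: eventually_at_top_linorder)
  \<comment> \<open>The second term extends the bound to 0 <= t < \<open>t0\<close>, where the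
    probability is at most 1 and the exponential is increasing.\<close>
  define D where "D = max C (exp ((max t0 0 / K) powr q))"
  define Z where "Z x = (\<bar>X x\<bar> / K) powr q" for x
  have [measurable]: "Z \<in> borel_measurable M" unfolding Z_def by measurable
  have tail: "prob {x \<in> space M. \<bar>X x\<bar> > t} * exp ((t / K) powr q) \<le> D" if "t \<ge> 0" for t
  proof (cases "t \<ge> t0")
    case True
    then show ?thesis using t0 unfolding D_def by fastforce
  next
    case False
    have "prob {x \<in> space M. \<bar>X x\<bar> > t} * exp ((t / K) powr q) \<le> 1 * exp ((max t0 0 / K) powr q)"
      using False that assms
      by (intro mult_mono) (auto intro!: powr_mono2 divide_right_mono)
    then show ?thesis unfolding D_def by simp
  qed
  have "prob {x \<in> space M. Z x > real n} \<le> D * exp (- real n)" for n :: nat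
  proof -
    \<comment> \<open>The level at which the events |X| > t and Z > n coincide.\<close>
    define t where "t = K * real n powr (1 / q)"
    have n: "(t / K) powr q = real n" "t \<ge> 0"
      using assms by (simp_all add: t_def powr_powr)
    have "Z x > real n \<longleftrightarrow> \<bar>X x\<bar> > t" for x
      unfolding Z_def n(1)[symmetric]
      using assms n(2) by (simp add: powr_less_base_iff divide_less_cancel)
    with tail[OF n(2)] n(1) show ?thesis
      by (simp add: exp_minus field_simps)
  qed
  from tail_imp_nn_integral_exp_half_finite[OF _ this]
  have fin: "(\<integral>\<^sup>+ x. ennreal (exp (Z x / 2)) \<partial>M) < \<infinity>" by simp
  \<comment> \<open>Chosen so that (l |X|)^q = Z / 2.\<close>
  define l where "l = (1 / 2) powr (1 / q) / K"
  have "l powr q * \<bar>X x\<bar> powr q = Z x / 2" for x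
    using assms by (simp add: l_def Z_def powr_divide powr_mult powr_powr)
  then have "(\<integral>\<^sup>+ x. ennreal (exp (l powr q * \<bar>X x\<bar> powr q)) \<partial>M) < \<infinity>"
    using fin by (simp only:)
  moreover have "l > 0" using assms(3) by (simp add: l_def)
  ultimately show ?thesis unfolding subweibull_def by blast
qed

section \<open>Growth of absolute moments\<close>

lemma subweibull_imp_moments:
  assumes [measurable]: "X \<in> borel_measurable M" and "q > 0" and "subweibull M q X"
  obtains B where "B > 0"
    "\<And>p. p \<ge> 1 \<Longrightarrow> abs_moment M X p \<le> ennreal ((B * p powr (1 / q)) powr p)"
proof -
  obtain l where l: "l > 0" "(\<integral>\<^sup>+ x. ennreal (exp (l powr q * \<bar>X x\<bar> powr q)) \<partial>M) < \<infinity>"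
    using assms unfolding subweibull_def by blast
  then obtain C where C: "C \<ge> 0" "(\<integral>\<^sup>+ x. ennreal (exp (l powr q * \<bar>X x\<bar> powr q)) \<partial>M) = ennreal C"
    by (metis ennreal_cases infinity_ennreal_def less_irrefl)
  \<comment> \<open>The factor \<open>C\<close> has to fit inside a p-th power: since
    \<open>D\<close> and \<open>p\<close> are at least 1, C <= D <= D^p.\<close>
  define D where "D = max 1 C"
  define B where "B = (1 / q) powr (1 / q) / l * D"
  have "abs_moment M X p \<le> ennreal ((B * p powr (1 / q)) powr p)" if p: "p \<ge> 1" for p
  proof -
    define E where "E = ((1 / q) powr (1 / q) / l * p powr (1 / q)) powr p"
    \<comment> \<open>This is s^s / l^p with s = p / q, the factor that arises from y^s <= s^s exp y
      after dividing by l^p.\<close>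
    have E: "E = (p / q) powr (p / q) / l powr p"
      using p l assms(2) by (simp add: E_def powr_mult powr_divide powr_powr)
    have "\<bar>X x\<bar> powr p \<le> E * exp (l powr q * \<bar>X x\<bar> powr q)" for x
    proof -
      have "l powr p * \<bar>X x\<bar> powr p = (l powr q * \<bar>X x\<bar> powr q) powr (p / q)"
        using l assms(2) by (simp add: powr_mult powr_powr)
      also have "\<dots> \<le> (p / q) powr (p / q) * exp (l powr q * \<bar>X x\<bar> powr q)"
        using l assms(2) p by (intro powr_le_powr_self_mult_exp) auto
      finally show ?thesis using l by (simp add: E field_simps)
    qed
    then have "abs_moment M X p \<le> (\<integral>\<^sup>+ x. ennreal E * ennreal (exp (l powr q * \<bar>X x\<bar> powr q)) \<partial>M)"
      unfolding abs_moment_def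
      by (intro nn_integral_mono) (auto simp: ennreal_mult''[symmetric] E_def intro!: ennreal_leI)
    also have "\<dots> = ennreal (E * C)"
      using C by (simp add: nn_integral_cmult E_def ennreal_mult)
    also have "E * C \<le> E * D powr p"
    proof (rule mult_left_mono)
      have "C \<le> D powr 1" by (simp add: D_def)
      also have "\<dots> \<le> D powr p" using p by (intro powr_mono) (auto simp: D_def)
      finally show "C \<le> D powr p" .
    qed (simp add: E_def)
    also have "E * D powr p = (B * p powr (1 / q)) powr p"
      using l by (simp add: E_def B_def D_def powr_mult[symmetric] mult_ac)
    finally show ?thesis by (simp add: ennreal_leI)
  qed
  moreover have "B > 0" using l assms(2) by (simp add: B_def D_def)
  ultimately show thesis using that by blast
qed

lemma moments_imp_tail:
  assumes [measurable]: "X \<in> borel_measurable M" and "q > 0" and B: "B > 0"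
    and ev: "eventually (\<lambda>p. abs_moment M X p \<le> ennreal ((B * p powr (1 / q)) powr p)) at_top"
  shows "eventually (\<lambda>t. prob {x \<in> space M. \<bar>X x\<bar> > t} * exp ((t / (exp 1 * B)) powr q) \<le> 1) at_top"
proof -
  \<comment> \<open>The exponent \<open>p\<close> will depend on \<open>t\<close>; as it tends to
    infinity with \<open>t\<close>, the eventual moment bound may be used at it.\<close>
  have "filterlim (\<lambda>t. (t / (exp 1 * B)) powr q) at_top at_top"
    using assms by real_asymp
  from eventually_compose_filterlim[OF ev this] eventually_gt_at_top[of 0]
  show ?thesis
  proof eventually_elim
    case (elim t)
    define p where "p = (t / (exp 1 * B)) powr q"
    have p: "p > 0" "p powr (1 / q) = t / (exp 1 * B)"
      using elim assms by (auto simp: p_def powr_powr)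
    have "emeasure M {x \<in> space M. \<bar>X x\<bar> > t} * ennreal (t powr p) \<le> abs_moment M X p"
      unfolding abs_moment_def using elim p
      by (intro emeasure_mult_le_nn_integral ennreal_leI powr_mono2) auto
    also have "\<dots> \<le> ennreal ((B * p powr (1 / q)) powr p)"
      using elim by (simp add: p_def)
    finally have "prob {x \<in> space M. \<bar>X x\<bar> > t} * t powr p \<le> (B * p powr (1 / q)) powr p"
      by (simp add: emeasure_eq_measure ennreal_mult'[symmetric])
    also have "(B * p powr (1 / q)) powr p = t powr p * exp (- p)"
    proof -
      \<comment> \<open>The factor \<open>exp 1\<close> in the scale serves this identity: Markov's
        quotient becomes exactly exp (-p), which cancels the exponential weight and leaves the bound
        1.\<close>
      have "B * p powr (1 / q) = t * exp (- 1)"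
        unfolding p using B by (simp add: exp_minus field_simps)
      moreover have "exp (- 1 :: real) powr p = exp (- p)" by (simp add: powr_def)
      ultimately show ?thesis using elim by (simp add: powr_mult)
    qed
    finally have "prob {x \<in> space M. \<bar>X x\<bar> > t} \<le> exp (- p)"
      using elim by (simp add: mult.commute)
    then show ?case
      unfolding p_def[symmetric] by (simp add: exp_minus field_simps)
  qed
qed

end

section \<open>The two equivalences\<close>

theorem corollary3p0p1:
  fixes M :: "'a measure" and X :: "'a \<Rightarrow> real" and q :: real
  assumes "prob_space M" and "X \<in> borel_measurable M" and "q > 0"
  shows "(subweibull M q X \<longleftrightarrow>
           (\<exists>K>0. Limsup at_top
              (\<lambda>t::real. ereal (measure M {x \<in> space M. \<bar>X x\<bar> > t} * exp ((t / K) powr q))) < \<infinity>))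
       \<and> (subweibull M q X \<longleftrightarrow>
           Limsup at_top
              (\<lambda>p::real. ennreal_powr (abs_moment M X p) (1 / p) / ennreal (p powr (1 / q))) < \<infinity>)"
proof -
  interpret prob_space M by fact
  have moments_iff:
    "Limsup at_top (\<lambda>p::real. ennreal_powr (abs_moment M X p) (1 / p) / ennreal (p powr (1 / q))) < \<infinity>
      \<longleftrightarrow> (\<exists>B>0. eventually (\<lambda>p. abs_moment M X p \<le> ennreal ((B * p powr (1 / q)) powr p)) at_top)"
  proof -
    have "eventually (\<lambda>p. ennreal_powr (abs_moment M X p) (1 / p) / ennreal (p powr (1 / q)) \<le> ennreal B) at_top
        \<longleftrightarrow> eventually (\<lambda>p. abs_moment M X p \<le> ennreal ((B * p powr (1 / q)) powr p)) at_top"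
      if "B > 0" for B
      \<comment> \<open>The pointwise equivalence requires p > 0, which holds eventually; the
        constant \<open>B\<close> is the same on both sides.\<close>
      by (rule eventually_cong[OF eventually_gt_at_top[of 0]])
        (rule ennreal_powr_divide_le_iff, use that in simp_all)
    then show ?thesis unfolding Limsup_ennreal_less_top_iff by blast
  qed
  have "subweibull M q X \<longleftrightarrow> (\<exists>K>0. Limsup at_top
      (\<lambda>t::real. ereal (measure M {x \<in> space M. \<bar>X x\<bar> > t} * exp ((t / K) powr q))) < \<infinity>)"
  proof
    assume "subweibull M q X"
    from subweibull_imp_tail[OF assms(2,3) this] obtain K C where "K > 0"
      "\<And>t. t \<ge> 0 \<Longrightarrow> prob {x \<in> space M. \<bar>X x\<bar> > t} * exp ((t / K) powr q) \<le> C" by blast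
    then show "\<exists>K>0. Limsup at_top
      (\<lambda>t::real. ereal (measure M {x \<in> space M. \<bar>X x\<bar> > t} * exp ((t / K) powr q))) < \<infinity>"
      unfolding Limsup_ereal_less_top_iff ereal_less_eq eventually_at_top_linorder by blast
  next
    assume "\<exists>K>0. Limsup at_top
      (\<lambda>t::real. ereal (measure M {x \<in> space M. \<bar>X x\<bar> > t} * exp ((t / K) powr q))) < \<infinity>"
    then show "subweibull M q X"
      unfolding Limsup_ereal_less_top_iff ereal_less_eq
      using tail_imp_subweibull[OF assms(2,3)] by blast
  qed
  moreover have "subweibull M q X \<longleftrightarrow>
      (\<exists>B>0. eventually (\<lambda>p. abs_moment M X p \<le> ennreal ((B * p powr (1 / q)) powr p)) at_top)"
  proof
    assume "subweibull M q X"
    from subweibull_imp_moments[OF assms(2,3) this] obtain B where "B > 0"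
      "\<And>p. p \<ge> 1 \<Longrightarrow> abs_moment M X p \<le> ennreal ((B * p powr (1 / q)) powr p)" by blast
    then show "\<exists>B>0. eventually (\<lambda>p. abs_moment M X p \<le> ennreal ((B * p powr (1 / q)) powr p)) at_top"
      unfolding eventually_at_top_linorder by blast
  next
    assume "\<exists>B>0. eventually (\<lambda>p. abs_moment M X p \<le> ennreal ((B * p powr (1 / q)) powr p)) at_top"
    then obtain B where B: "B > 0"
      "eventually (\<lambda>p. abs_moment M X p \<le> ennreal ((B * p powr (1 / q)) powr p)) at_top" by blast
    \<comment> \<open>The return from moments to the exponential moment passes through the tail
      bound, with \<open>K = exp 1 * B\<close> and \<open>C = 1\<close>.\<close>
    from tail_imp_subweibull[OF assms(2,3) _ moments_imp_tail[OF assms(2,3) B]] B(1)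
    show "subweibull M q X" by simp
  qed
  ultimately show ?thesis unfolding moments_iff by blast
qed

end
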